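(* Let $X$ be a regular topological space, let $\mathcal{I}$ be an ideal on $\omega$, and let $\bm{x}=(x_n)_{n\in\omega}$ be a sequence taking values in $X$ such that $\{n\in\omega: x_n\notin K\}\in\mathcal{I}$ for some compact set $K\subseteq X$. Let $\mathscr{F}=\{F_\eta:\eta\in X\}$ be a rough family, and pick $\eta\in X$ such that $F_\eta$ is closed. Then $$(\mathcal{I},\mathscr{F})\text{-}\lim_n x_n=\eta \quad\text{ if and only if }\quad \Gamma_{\bm{x}}(\mathcal{I})\subseteq F_\eta.$$
   Context: $\omega$ denotes the set of nonnegative integers. An ideal on $\omega$ is a family $\mathcal{I}\subseteq\mathcal{P}(\omega)$ closed under subsets and finite unions, containing all finite subsets of $\omega$, and with $\omega\notin\mathcal{I}$. Topological spaces are not assumed to be Hausdorff. Regular means that a closed set and a point outside it can be separated by disjoint open sets. A rough family on a topological space $X$ is a collection $\mathscr{F}=\{F_\eta:\eta\in X\}$ of subsets of $X$ such that $\eta\in F_\eta$ for all $\eta\in X$. A sequence $(x_n)_{n\in\omega}$ in $X$ is $\mathcal{I}$-convergent to $\eta\in X$ with roughness $\mathscr{F}$, written $(\mathcal{I},\mathscr{F})\text{-}\lim_n x_n=\eta$, if $\{n\in\omega: x_n\notin U\}\in\mathcal{I}$ for all open sets $U\subseteq X$ with $F_\eta\subseteq U$. A point $\eta\in X$ is an $\mathcal{I}$-cluster point of $\bm{x}=(x_n)$ if $\{n\in\omega: x_n\in U\}\notin\mathcal{I}$ for all open sets $U$ containing $\eta$; $\Gamma_{\bm{x}}(\mathcal{I})$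 denotes the set of $\mathcal{I}$-cluster points of $\bm{x}$. *)

theory Defs
  imports "HOL-Analysis.Analysis"
begin

definition ideal_on_omega :: "nat set set \<Rightarrow> bool" where
  "ideal_on_omega I \<longleftrightarrow>
     (\<forall>A\<in>I. \<forall>B. B \<subseteq> A \<longrightarrow> B \<in> I) \<and>
     (\<forall>A\<in>I. \<forall>B\<in>I. A \<union> B \<in> I) \<and>
     (\<forall>A. finite A \<longrightarrow> A \<in> I) \<and>
     UNIV \<notin> I"

text \<open>A family indexed by the points of the space; the values of \<open>F\<close> outside
  \<open>topspace X\<close> are irrelevant.\<close>

definition rough_family :: "'a topology \<Rightarrow> ('a \<Rightarrow> 'a set) \<Rightarrow> bool" where
  "rough_family X F \<longleftrightarrow> (\<forall>\<eta>\<in>topspace X. F \<eta> \<subseteq> topspace X \<and> \<eta> \<in> F \<eta>)"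

definition rough_ideal_convergent ::
    "'a topology \<Rightarrow> nat set set \<Rightarrow> ('a \<Rightarrow> 'a set) \<Rightarrow> (nat \<Rightarrow> 'a) \<Rightarrow> 'a \<Rightarrow> bool" where
  "rough_ideal_convergent X I F x \<eta> \<longleftrightarrow>
     \<eta> \<in> topspace X \<and> (\<forall>U. openin X U \<and> F \<eta> \<subseteq> U \<longrightarrow> {n. x n \<notin> U} \<in> I)"

definition ideal_cluster_points ::
    "'a topology \<Rightarrow> nat set set \<Rightarrow> (nat \<Rightarrow> 'a) \<Rightarrow> 'a set" where
  "ideal_cluster_points X I x =
     {\<eta> \<in> topspace X. \<forall>U. openin X U \<and> \<eta> \<in> U \<longrightarrow> {n. x n \<in> U} \<notin> I}"

end

theory Submission imports Defs
begin

text \<open>Necessity: by regularity, a cluster point outside the closed set \<open>F \<eta>\<close> has an open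
  neighbourhood disjoint from an open superset of \<open>F \<eta>\<close>, so the sequence enters that
  neighbourhood only along a set in the ideal. Sufficiency: for open \<open>U \<supseteq> F \<eta>\<close>,
  the compact set \<open>K - U\<close> contains no cluster point, so finitely many open sets, each visited
  only along a set in the ideal, cover it.\<close>

lemma ideal_on_omega_subset:
  assumes "ideal_on_omega I" "A \<in> I" "B \<subseteq> A"
  shows "B \<in> I"
  using assms unfolding ideal_on_omega_def by blast

lemma ideal_on_omega_Un:
  assumes "ideal_on_omega I" "A \<in> I" "B \<in> I"
  shows "A \<union> B \<in> I"
  using assms unfolding ideal_on_omega_def by blast

lemma ideal_on_omega_finite_UN:
  assumes I: "ideal_on_omega I" and "finite S" and "\<And>s. s \<in> S \<Longrightarrow> A s \<in> I"
  shows "(\<Union>s\<in>S. A s) \<in> I"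
  using assms(2,3)
proof (induction S rule: finite_induct)
  case empty
  then show ?case using I unfolding ideal_on_omega_def by simp
next
  case (insert s S)
  then show ?case by (simp add: ideal_on_omega_Un[OF I])
qed

text \<open>Failing to be a cluster point is witnessed by a single open neighbourhood whose visit
  set lies in \<open>I\<close>. Such neighbourhoods cover \<open>K\<close>, and compactness leaves a
  finite union of their visit sets.\<close>

lemma compactin_disjoint_cluster_points_preimage:
  assumes I: "ideal_on_omega I" and K: "compactin X K"
    and disj: "disjnt K (ideal_cluster_points X I x)"
  shows "{n. x n \<in> K} \<in> I"
proof -
  define \<U> where "\<U> = {V. openin X V \<and> {n. x n \<in> V} \<in> I}"
  have "K \<subseteq> \<Union>\<U>"
    using compactin_subset_topspace[OF K] disj
    unfolding \<U>_def ideal_cluster_points_def disjnt_iff by blast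
  then obtain \<V> where \<V>: "finite \<V>" "\<V> \<subseteq> \<U>" "K \<subseteq> \<Union>\<V>"
    using K unfolding compactin_def \<U>_def by (metis (no_types, lifting) mem_Collect_eq)
  have "(\<Union>V\<in>\<V>. {n. x n \<in> V}) \<in> I"
    using \<V> by (intro ideal_on_omega_finite_UN[OF I]) (auto simp: \<U>_def)
  then show ?thesis
    by (rule ideal_on_omega_subset[OF I]) (use \<V>(3) in blast)
qed

theorem theorem1p3:
  fixes X :: "'a topology"
    and I :: "nat set set"
    and x :: "nat \<Rightarrow> 'a"
    and F :: "'a \<Rightarrow> 'a set"
    and \<eta> :: 'a
  assumes "regular_space X"
    and "ideal_on_omega I"
    and "\<And>n. x n \<in> topspace X"
    and "\<exists>K. compactin X K \<and> {n. x n \<notin> K} \<in> I"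
    and "rough_family X F"
    and "\<eta> \<in> topspace X"
    and "closedin X (F \<eta>)"
  shows "rough_ideal_convergent X I F x \<eta> \<longleftrightarrow> ideal_cluster_points X I x \<subseteq> F \<eta>"
proof
  assume conv: "rough_ideal_convergent X I F x \<eta>"
  show "ideal_cluster_points X I x \<subseteq> F \<eta>"
  proof
    fix z
    assume z: "z \<in> ideal_cluster_points X I x"
    show "z \<in> F \<eta>"
    proof (rule ccontr)
      assume "z \<notin> F \<eta>"
      with z have "z \<in> topspace X - F \<eta>"
        by (simp add: ideal_cluster_points_def)
      with \<open>regular_space X\<close> \<open>closedin X (F \<eta>)\<close>
      obtain U V where UV: "openin X U" "openin X V" "z \<in> U" "F \<eta> \<subseteq> V" "disjnt U V"
        unfolding regular_space_def by metis
      have "{n. x n \<notin> V} \<in> I"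
        using conv UV unfolding rough_ideal_convergent_def by blast
      \<comment> \<open>Since \<open>U\<close> and \<open>V\<close> are disjoint, each visit to
        \<open>U\<close> is a time outside \<open>V\<close>.\<close>
      then have "{n. x n \<in> U} \<in> I"
        by (rule ideal_on_omega_subset[OF \<open>ideal_on_omega I\<close>])
          (use UV(5) in \<open>auto simp: disjnt_iff\<close>)
      then show False
        using z UV unfolding ideal_cluster_points_def by blast
    qed
  qed
next
  assume sub: "ideal_cluster_points X I x \<subseteq> F \<eta>"
  obtain K where K: "compactin X K" "{n. x n \<notin> K} \<in> I"
    using assms(4) by blast
  have "{n. x n \<notin> U} \<in> I" if U: "openin X U" "F \<eta> \<subseteq> U" for U
  proof -
    \<comment> \<open>\<open>K\<close> may fail to be closed, as \<open>X\<close> need not be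
      Hausdorff, but cutting it with the closed complement of \<open>U\<close> keeps it compact. All
      cluster points lie in \<open>F \<eta>\<close>, hence in \<open>U\<close>, so the cut contains
      none.\<close>
    have "compactin X (K \<inter> (topspace X - U))"
      using K(1) U(1) by (intro compact_Int_closedin) auto
    then have "{n. x n \<in> K \<inter> (topspace X - U)} \<in> I"
      by (rule compactin_disjoint_cluster_points_preimage[OF \<open>ideal_on_omega I\<close>])
        (use sub U(2) in \<open>auto simp: disjnt_iff\<close>)
    \<comment> \<open>A term outside \<open>U\<close> is either in \<open>K\<close> and in the
      complement of \<open>U\<close>, or outside \<open>K\<close>.\<close>
    from ideal_on_omega_Un[OF \<open>ideal_on_omega I\<close> this K(2)] show ?thesis
      by (rule ideal_on_omega_subset[OF \<open>ideal_on_omega I\<close>]) (use assms(3) in auto)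
  qed
  with \<open>\<eta> \<in> topspace X\<close> show "rough_ideal_convergent X I F x \<eta>"
    unfolding rough_ideal_convergent_def by blast
qed

end
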